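(* Let $k\ge 1$, let $H$ be a subgroup of rank $k$ in $\mathbb{Z}^{k}$, and let $A$ be a $k\times k$ integer matrix whose columns form a $\mathbb{Z}$-basis for $H$. Let $A^{*}=((a^{*}_{ij}))$ be the adjoint matrix of $A$. Then the following are equivalent. (1) $H$ is an ideal in the ring $\mathbb{Z}^{k}$. (2) There exists a unimodular matrix $U$ such that $AU$ is a diagonal matrix. (3) There is a sequence of $k$ non-zero integers $d_1,d_2,\dots,d_k$ such that (a) $\det(A)=\pm d_1d_2\cdots d_k$, and (b) $\det(A)/d_i$ divides $\gcd(a^{*}_{1i},\dots,a^{*}_{ki})$ for all $i$.
   Context: $\mathbb{Z}^k$ is the product ring with componentwise operations; a subgroup of a ring means a subgroup of its additive group, and its rank is its rank as a free $\mathbb{Z}$-module. An integer square matrix is unimodular if it is invertible over $\mathbb{Z}$ (equivalently has determinant $\pm1$). The adjoint matrix $A^*$ is the classical adjoint (adjugate), so that $A^{-1}=\frac{1}{\det(A)}A^{*}$ over the rationals; $a^*_{ij}$ is its entry in row $i$ and column $j$. *)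

theory Defs
  imports "Jordan_Normal_Form.VS_Connect" "HOL-Algebra.Ideal"
begin

text \<open>The product ring \<open>\<int>\<^sup>k\<close>. Its additive group is that of \<^term>\<open>module_vec TYPE(int) k\<close>, whose
  \<^term>\<open>mult\<close> and \<^term>\<open>one\<close> fields are \<^term>\<open>undefined\<close>.\<close>

definition int_vec_ring :: "nat \<Rightarrow> int vec ring" where
  "int_vec_ring k = \<lparr>
     carrier = carrier_vec k,
     mult = (\<lambda>x y. vec k (\<lambda>i. x $ i * y $ i)),
     one = vec k (\<lambda>i. 1),
     zero = 0\<^sub>v k,
     add = (+)\<rparr>"

lemma cring_int_vec_ring: "cring (int_vec_ring k)"
proof (rule cringI)
  have "\<exists>y\<in>carrier_vec k. y + x = 0\<^sub>v k" if "x \<in> carrier_vec k" for x :: "int vec"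
    using that by (intro bexI[of _ "- x"]) auto
  then show "abelian_group (int_vec_ring k)"
    by (intro abelian_groupI) (auto simp: int_vec_ring_def ac_simps)
  show "Group.comm_monoid (int_vec_ring k)"
    by (rule comm_monoidI) (auto simp: int_vec_ring_def)
qed (auto simp: int_vec_ring_def algebra_simps)

context vec_module
begin

text \<open>Used with \<open>'a = int\<close>: \<^term>\<open>B\<close> is a basis of the free submodule \<^term>\<open>H\<close> of \<open>\<int>\<^sup>n\<close>, and \<^term>\<open>H\<close> is
  free of rank \<^term>\<open>r\<close>. The rank is a relation, so it does not presuppose that a basis exists.\<close>

definition free_basis :: "'a vec set \<Rightarrow> 'a vec set \<Rightarrow> bool" where
  "free_basis H B \<longleftrightarrow> B \<subseteq> carrier_vec n \<and> lin_indpt B \<and> span B = H"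

definition has_free_rank :: "'a vec set \<Rightarrow> nat \<Rightarrow> bool" where
  "has_free_rank H r \<longleftrightarrow> (\<exists>B. free_basis H B \<and> finite B \<and> card B = r)"

end

text \<open>\<^const>\<open>invertible_mat\<close> asks for an inverse over the entry type, so at type \<^typ>\<open>int mat\<close> it is
  invertibility over \<open>\<int>\<close>.\<close>

definition unimodular_mat :: "int mat \<Rightarrow> bool" where
  "unimodular_mat U \<longleftrightarrow> invertible_mat U"

end

theory Submission
  imports Defs "HOL-Computational_Algebra.Group_Closure"
begin

text \<open>That the columns of \<open>A\<close> form a basis of \<open>H\<close> means that \<open>H\<close> is the lattice \<open>A \<int>\<^sup>k\<close> and that
  \<open>det A \<noteq> 0\<close> (\<open>span_cols_eq_column_lattice\<close>, \<open>lin_indpt_cols_imp_det_nonzero\<close>).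

  An ideal \<open>I\<close> of \<open>\<int>\<^sup>k\<close> contains the product of each of its elements with each idempotent \<open>e\<^sub>i\<close>, so it
  splits as the direct sum of its coordinate projections. Each projection is a subgroup \<open>d\<^sub>i \<int>\<close> of \<open>\<int>\<close>,
  so the ideals are exactly the lattices \<open>D \<int>\<^sup>k\<close> with \<open>D\<close> diagonal (\<open>ideal_int_vec_ring_iff\<close>). On the
  other hand, \<open>A\<close> and \<open>D\<close> span the same lattice if and only if \<open>D = A U\<close> with \<open>U\<close> unimodular
  (\<open>same_lattice_iff\<close>). Together these give the equivalence of (1) and (2).

  For (2) and (3), let \<open>D = diag(d\<^sub>1, \<dots>, d\<^sub>k)\<close>. Then \<open>U = A\<^sup>-\<^sup>1 D\<close> is the only possible choice, and its
  column \<open>i\<close> is \<open>d\<^sub>i / det A\<close> times column \<open>i\<close> of the adjugate. If \<open>d\<^sub>i\<close> divides \<open>det A\<close>, this column is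
  integral precisely when \<open>det A / d\<^sub>i\<close> divides all its adjugate entries, which is (b); and
  \<open>det U = (\<Prod>i. d\<^sub>i) / det A\<close> is \<open>\<plusminus>1\<close> precisely when (a) holds (\<open>exists_unimodular_diag_iff\<close>).\<close>


section \<open>Diagonal matrices, adjugates and unimodularity\<close>

lemma det_mat_diag: "det (mat_diag k d) = (\<Prod>i<k. d i)"
proof -
  have "det (mat_diag k d) = prod_list (diag_mat (mat_diag k d))"
    by (rule det_upper_triangular[where n = k]) (auto simp: mat_diag_def upper_triangular_def)
  also have "\<dots> = (\<Prod>i = 0..<k. mat_diag k d $$ (i, i))"
    unfolding prod_list_diag_prod by (simp add: mat_diag_def)
  also have "\<dots> = (\<Prod>i<k. d i)"
    unfolding lessThan_atLeast0 by (rule prod.cong) (auto simp: mat_diag_def)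
  finally show ?thesis .
qed

lemma diagonal_mat_iff_mat_diag:
  assumes "D \<in> carrier_mat k k"
  shows "diagonal_mat D \<longleftrightarrow> (\<exists>d. D = mat_diag k d)"
proof
  assume "diagonal_mat D"
  then have "D = mat_diag k (\<lambda>i. D $$ (i, i))"
    using assms by (intro eq_matI) (auto simp: mat_diag_def diagonal_mat_def)
  then show "\<exists>d. D = mat_diag k d" by blast
qed (auto simp: diagonal_mat_def mat_diag_def)

lemma mat_diag_mult_vec:
  fixes d :: "nat \<Rightarrow> 'a :: comm_ring_1"
  assumes "x \<in> carrier_vec k"
  shows "mat_diag k d *\<^sub>v x = vec k (\<lambda>i. d i * x $ i)"
proof (rule eq_vecI)
  fix i assume "i < dim_vec (vec k (\<lambda>i. d i * x $ i))"
  then have i: "i < k" by simp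
  have "(mat_diag k d *\<^sub>v x) $ i = (\<Sum>j = 0..<k. (if i = j then d j else 0) * x $ j)"
    using i assms by (simp add: mat_diag_def scalar_prod_def)
  also have "\<dots> = (\<Sum>j = 0..<k. if i = j then d j * x $ j else 0)"
    by (rule sum.cong) auto
  also have "\<dots> = d i * x $ i"
    using i by simp
  finally show "(mat_diag k d *\<^sub>v x) $ i = vec k (\<lambda>i. d i * x $ i) $ i"
    using i by simp
qed (simp add: mat_diag_def)

lemma smult_mat_left_cancel:
  fixes c :: "'a :: idom"
  assumes "c \<noteq> 0" and "c \<cdot>\<^sub>m B = c \<cdot>\<^sub>m C"
  shows "B = C"
proof (rule eq_matI)
  have dims: "dim_row B = dim_row C" "dim_col B = dim_col C"
    using arg_cong[OF assms(2), of dim_row] arg_cong[OF assms(2), of dim_col] by auto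
  then show "dim_row B = dim_row C" "dim_col B = dim_col C" .
  fix i j assume ij: "i < dim_row C" "j < dim_col C"
  have "(c \<cdot>\<^sub>m B) $$ (i, j) = (c \<cdot>\<^sub>m C) $$ (i, j)"
    using assms(2) by simp
  then show "B $$ (i, j) = C $$ (i, j)"
    using ij dims assms(1) by simp
qed

text \<open>A form of \<open>U = A\<^sup>-\<^sup>1 D\<close> that avoids fractions.\<close>

lemma mult_eq_iff_adj_mat:
  fixes A :: "'a :: idom mat"
  assumes A: "A \<in> carrier_mat k k" and U: "U \<in> carrier_mat k k" and D: "D \<in> carrier_mat k k"
    and det: "det A \<noteq> 0"
  shows "A * U = D \<longleftrightarrow> det A \<cdot>\<^sub>m U = adj_mat A * D"
proof
  note adj = adj_mat[OF A]
  show "det A \<cdot>\<^sub>m U = adj_mat A * D" if "A * U = D"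
  proof -
    have "adj_mat A * D = (adj_mat A * A) * U"
      using that adj(1) A U by (simp add: assoc_mult_mat[of _ k k _ k _ k])
    also have "\<dots> = det A \<cdot>\<^sub>m U"
      using U by (simp add: adj(3) mult_smult_assoc_mat[of _ k k _ k])
    finally show ?thesis ..
  qed
  show "A * U = D" if eq: "det A \<cdot>\<^sub>m U = adj_mat A * D"
  proof (rule smult_mat_left_cancel[OF det])
    have "det A \<cdot>\<^sub>m (A * U) = A * (det A \<cdot>\<^sub>m U)"
      using A U by (simp add: mult_smult_distrib)
    also have "\<dots> = (A * adj_mat A) * D"
      unfolding eq using A adj(1) D by (simp add: assoc_mult_mat[of _ k k _ k _ k])
    also have "\<dots> = det A \<cdot>\<^sub>m D"
      using D by (simp add: adj(2) mult_smult_assoc_mat[of _ k k _ k])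
    finally show "det A \<cdot>\<^sub>m (A * U) = det A \<cdot>\<^sub>m D" .
  qed
qed

lemma mult_left_cancel_det:
  fixes A :: "'a :: idom mat"
  assumes "A \<in> carrier_mat k k" "B \<in> carrier_mat k k" "C \<in> carrier_mat k k"
    and "det A \<noteq> 0" and "A * B = A * C"
  shows "B = C"
proof (rule smult_mat_left_cancel[OF assms(4)])
  have AC: "A * C \<in> carrier_mat k k"
    using assms by simp
  show "det A \<cdot>\<^sub>m B = det A \<cdot>\<^sub>m C"
    using mult_eq_iff_adj_mat[OF assms(1,2) AC assms(4)] mult_eq_iff_adj_mat[OF assms(1,3) AC assms(4)]
      assms(5) by simp
qed

lemma unimodular_mat_iff_inverse:
  assumes "U \<in> carrier_mat k k"
  shows "unimodular_mat U \<longleftrightarrow> (\<exists>W \<in> carrier_mat k k. U * W = 1\<^sub>m k \<and> W * U = 1\<^sub>m k)"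
proof
  assume "unimodular_mat U"
  then obtain W where W: "U * W = 1\<^sub>m k" "W * U = 1\<^sub>m (dim_row W)"
    using assms by (auto simp: unimodular_mat_def invertible_mat_def inverts_mat_def)
  have "dim_col W = k" "dim_row W = k"
    using arg_cong[OF W(1), of dim_col] arg_cong[OF W(2), of dim_col] assms by auto
  with W show "\<exists>W \<in> carrier_mat k k. U * W = 1\<^sub>m k \<and> W * U = 1\<^sub>m k"
    by auto
qed (use assms in \<open>auto simp: unimodular_mat_def invertible_mat_def inverts_mat_def\<close>)

lemma unimodular_mat_iff_is_unit_det:
  assumes U: "U \<in> carrier_mat k k"
  shows "unimodular_mat U \<longleftrightarrow> is_unit (det U)"
proof
  assume "unimodular_mat U"
  then obtain W where "W \<in> carrier_mat k k" "U * W = 1\<^sub>m k"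
    using unimodular_mat_iff_inverse[OF U] by blast
  then have "det U * det W = 1"
    using det_mult[OF U, of W] by simp
  then show "is_unit (det U)"
    by (metis dvd_triv_left)
next
  assume "is_unit (det U)"
  then obtain c where c: "c * det U = 1"
    by (metis dvdE mult.commute)
  note adj = adj_mat[OF U]
  have "c \<cdot>\<^sub>m (det U \<cdot>\<^sub>m 1\<^sub>m k) = 1\<^sub>m k"
    using c by (intro eq_matI) auto
  then have "U * (c \<cdot>\<^sub>m adj_mat U) = 1\<^sub>m k" "(c \<cdot>\<^sub>m adj_mat U) * U = 1\<^sub>m k"
    using U adj by (simp_all add: mult_smult_distrib[of _ k k] mult_smult_assoc_mat[of _ k k])
  then show "unimodular_mat U"
    unfolding unimodular_mat_iff_inverse[OF U] using adj(1) by (intro bexI[of _ "c \<cdot>\<^sub>m adj_mat U"]) auto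
qed


section \<open>Lattices spanned by the columns of a matrix\<close>

text \<open>Column \<open>j\<close> of \<open>U\<close> lists the coefficients that express column \<open>j\<close> of \<open>B\<close> in the columns of \<open>A\<close>.\<close>

lemma column_lattice_subset_iff:
  fixes A B :: "'a :: comm_ring_1 mat"
  assumes A: "A \<in> carrier_mat n k" and B: "B \<in> carrier_mat n m"
  shows "(*\<^sub>v) B ` carrier_vec m \<subseteq> (*\<^sub>v) A ` carrier_vec k
    \<longleftrightarrow> (\<exists>U \<in> carrier_mat k m. B = A * U)"
proof
  assume sub: "(*\<^sub>v) B ` carrier_vec m \<subseteq> (*\<^sub>v) A ` carrier_vec k"
  have "\<exists>x \<in> carrier_vec k. col B j = A *\<^sub>v x" if "j < m" for j
  proof -
    have "col B j = B *\<^sub>v unit_vec m j"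
      using B that by (intro eq_vecI) auto
    moreover have "B *\<^sub>v unit_vec m j \<in> (*\<^sub>v) A ` carrier_vec k"
      using sub by (rule subsetD) simp
    ultimately show ?thesis
      by auto
  qed
  then obtain x where x: "\<And>j. j < m \<Longrightarrow> x j \<in> carrier_vec k" "\<And>j. j < m \<Longrightarrow> col B j = A *\<^sub>v x j"
    by metis
  define U where "U = mat_of_cols k (map x [0..<m])"
  have U: "U \<in> carrier_mat k m"
    by (simp add: U_def mat_of_cols_def)
  have colU: "col U j = x j" if "j < m" for j
    using that x(1) by (simp add: U_def)
  have "B = A * U"
  proof (rule eq_matI)
    fix i j assume "i < dim_row (A * U)" "j < dim_col (A * U)"
    then have ij: "i < n" "j < m"
      using A U by auto
    then have "B $$ (i, j) = col B j $ i"
      using B by simp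
    also have "\<dots> = (A * U) $$ (i, j)"
      using ij A U x(2) colU by simp
    finally show "B $$ (i, j) = (A * U) $$ (i, j)" .
  qed (use A B U in auto)
  then show "\<exists>U \<in> carrier_mat k m. B = A * U"
    using U by blast
next
  assume "\<exists>U \<in> carrier_mat k m. B = A * U"
  then obtain U where "U \<in> carrier_mat k m" "B = A * U" by blast
  then show "(*\<^sub>v) B ` carrier_vec m \<subseteq> (*\<^sub>v) A ` carrier_vec k"
    using A by (auto simp: assoc_mult_mat_vec[of _ n k _ m])
qed

text \<open>If each of two matrices is a right multiple of the other, \<open>D = A U\<close> and \<open>A = D V\<close>, then
  \<open>A U V = A\<close>, and the non-singular factor \<open>A\<close> can be cancelled.\<close>

lemma same_lattice_iff:
  fixes A D :: "int mat"
  assumes A: "A \<in> carrier_mat k k" and D: "D \<in> carrier_mat k k" and det: "det A \<noteq> 0"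
  shows "(*\<^sub>v) A ` carrier_vec k = (*\<^sub>v) D ` carrier_vec k
    \<longleftrightarrow> (\<exists>U \<in> carrier_mat k k. unimodular_mat U \<and> D = A * U)"
proof
  assume "(*\<^sub>v) A ` carrier_vec k = (*\<^sub>v) D ` carrier_vec k"
  then obtain U V where U: "U \<in> carrier_mat k k" "D = A * U" and V: "V \<in> carrier_mat k k" "A = D * V"
    using column_lattice_subset_iff[OF A D] column_lattice_subset_iff[OF D A] by blast
  have "A * (U * V) = D * V"
    unfolding U(2) using assoc_mult_mat[OF A U(1) V(1)] by simp
  also have "\<dots> = A * 1\<^sub>m k"
    unfolding V(2)[symmetric] using A by simp
  finally have "A * (U * V) = A * 1\<^sub>m k" .
  then have "U * V = 1\<^sub>m k"
    using mult_left_cancel_det[OF A _ _ det, of "U * V" "1\<^sub>m k"] U(1) V(1) by simp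
  then have "is_unit (det U)"
    using det_mult[OF U(1) V(1)] by (metis det_one dvd_triv_left)
  then show "\<exists>U \<in> carrier_mat k k. unimodular_mat U \<and> D = A * U"
    using U unimodular_mat_iff_is_unit_det by blast
next
  assume "\<exists>U \<in> carrier_mat k k. unimodular_mat U \<and> D = A * U"
  then obtain U W where U: "U \<in> carrier_mat k k" "D = A * U" and W: "W \<in> carrier_mat k k" "U * W = 1\<^sub>m k"
    using unimodular_mat_iff_inverse by blast
  have "A = D * W"
    unfolding U(2) using assoc_mult_mat[OF A U(1) W(1)] W(2) A by simp
  then show "(*\<^sub>v) A ` carrier_vec k = (*\<^sub>v) D ` carrier_vec k"
    using column_lattice_subset_iff[OF A D] column_lattice_subset_iff[OF D A] U W by blast
qed

lemma (in idom_vec) span_cols_eq_column_lattice: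
  assumes A: "A \<in> carrier_mat n k"
  shows "span (set (cols A)) = (*\<^sub>v) A ` carrier_vec k"
proof -
  have cols: "set (cols A) \<subseteq> carrier_vec n" and len: "length (cols A) = k"
    and mat: "mat_of_cols n (cols A) = A"
    using A cols_dim[of A] by auto
  have comb: "lincomb_list c (cols A) = A *\<^sub>v vec k c" for c
  proof -
    have "\<forall>w \<in> set (cols A). dim_vec w = n"
      using cols by auto
    from lincomb_list_as_mat_mult[OF this, of c] show ?thesis
      unfolding len mat .
  qed
  have "A *\<^sub>v x \<in> span_list (cols A)" if "x \<in> carrier_vec k" for x
  proof (rule in_span_listI)
    have "vec k (\<lambda>i. x $ i) = x"
      using that by auto
    then show "A *\<^sub>v x = lincomb_list (\<lambda>i. x $ i) (cols A)"
      unfolding comb by simp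
  qed simp
  then have "(*\<^sub>v) A ` carrier_vec k \<subseteq> span_list (cols A)"
    by (rule image_subsetI)
  moreover have "span_list (cols A) \<subseteq> (*\<^sub>v) A ` carrier_vec k"
  proof
    fix h assume "h \<in> span_list (cols A)"
    then obtain c where "h = A *\<^sub>v vec k c"
      by (rule in_span_listE) (simp add: comb)
    then show "h \<in> (*\<^sub>v) A ` carrier_vec k"
      by (rule image_eqI) simp
  qed
  ultimately show ?thesis
    unfolding span_list_as_span[OF cols, symmetric] by (rule equalityI[rotated])
qed

lemma (in idom_vec) lin_indpt_cols_imp_det_nonzero:
  assumes A: "A \<in> carrier_mat n n" and dist: "distinct (cols A)" and indpt: "lin_indpt (set (cols A))"
  shows "det A \<noteq> 0"
proof
  assume "det A = 0"
  then obtain v where v: "v \<in> carrier_vec n" "v \<noteq> 0\<^sub>v n" "A *\<^sub>v v = 0\<^sub>v n"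
    using det_0_iff_vec_prod_zero[OF A] by blast
  then obtain i where i: "i < n" "v $ i \<noteq> 0"
    by (metis carrier_vecD eq_vecI index_zero_vec)
  have cols: "set (cols A) \<subseteq> carrier_vec n" and len: "length (cols A) = n"
    and mat: "mat_of_cols n (cols A) = A"
    using A cols_dim[of A] by auto
  \<comment> \<open>As the columns are distinct, the entries of \<open>v\<close> can be read as coefficients indexed by columns.\<close>
  define f where "f l = (\<Sum>j \<in> {0..<n}. if l = cols A ! j then v $ j else 0)" for l
  have "f (cols A ! i) = (\<Sum>j \<in> {0..<n}. if i = j then v $ j else 0)"
    unfolding f_def using nth_eq_iff_index_eq[OF dist, of i] i(1) len by (intro sum.cong) auto
  then have "f (cols A ! i) \<noteq> 0"
    using i by simp
  moreover have "lincomb f (set (cols A)) = 0\<^sub>v n"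
    using mat_of_cols_mult_as_finsum[of v "cols A"] v cols len mat
    unfolding f_def by (metis nth_mem subsetD)
  moreover have "cols A ! i \<in> set (cols A)"
    using i len nth_mem[of i "cols A"] by metis
  ultimately have "lin_dep (set (cols A))"
    unfolding lin_dep_def by (intro exI[of _ "set (cols A)"] exI[of _ f] exI[of _ "cols A ! i"]) auto
  with indpt show False by blast
qed


section \<open>Ideals of the product ring\<close>

lemma additive_subgroup_int_vec_ringD:
  assumes "additive_subgroup I (int_vec_ring k)"
  shows "I \<subseteq> carrier_vec k" and "0\<^sub>v k \<in> I"
    and "x \<in> I \<Longrightarrow> y \<in> I \<Longrightarrow> x + y \<in> I" and "x \<in> I \<Longrightarrow> - x \<in> I"
proof -
  interpret additive_subgroup I "int_vec_ring k" by fact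
  interpret R: cring "int_vec_ring k" by (rule cring_int_vec_ring)
  show sub: "I \<subseteq> carrier_vec k" and "0\<^sub>v k \<in> I" and "x \<in> I \<Longrightarrow> y \<in> I \<Longrightarrow> x + y \<in> I"
    using a_subset zero_closed a_closed[of x y] by (simp_all add: int_vec_ring_def)
  show "- x \<in> I" if "x \<in> I"
  proof -
    have x: "x \<in> carrier_vec k" using that sub by blast
    then have "\<ominus>\<^bsub>int_vec_ring k\<^esub> x = - x"
      by (intro R.minus_equality) (auto simp: int_vec_ring_def)
    with a_inv_closed[OF that] show ?thesis by simp
  qed
qed

lemma ideal_int_vec_ringD:
  assumes "ideal I (int_vec_ring k)" "x \<in> I" "r \<in> carrier_vec k"
  shows "vec k (\<lambda>i. r $ i * x $ i) \<in> I"
  using ideal.I_l_closed[OF assms(1,2), of r] assms(3) by (simp add: int_vec_ring_def)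

text \<open>The generator \<open>d\<^sub>i\<close> of the \<open>i\<close>-th projection of an ideal is the gcd of the \<open>i\<close>-th coordinates of its
  elements. By Bezout it is itself such a coordinate, so multiplication by \<open>e\<^sub>i\<close> puts \<open>d\<^sub>i e\<^sub>i\<close> into the
  ideal.\<close>

lemma ideal_int_vec_ring_imp_diag:
  assumes I: "ideal I (int_vec_ring k)"
  shows "\<exists>d. I = (*\<^sub>v) (mat_diag k d) ` carrier_vec k"
proof -
  note sub = additive_subgroup_int_vec_ringD[OF ideal.axioms(1)[OF I]]
  define P where "P i = (\<lambda>h. h $ i) ` I" for i
  define d where "d i = Gcd (P i)" for i
  have d_in: "\<exists>h \<in> I. h $ i = d i" if i: "i < k" for i
  proof -
    have I_diff: "x - y \<in> I" if "x \<in> I" "y \<in> I" for x y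
    proof -
      have "x - y = x + - y"
        using that sub(1) by (intro eq_vecI) auto
      then show ?thesis using that sub(3,4) by simp
    qed
    have "s \<in> P i" if "s \<in> group_closure (P i)" for s
      using that
    proof induction
      case (base s)
      moreover have "0 \<in> P i"
        unfolding P_def using sub(2) i by (intro image_eqI[of _ _ "0\<^sub>v k"]) auto
      ultimately show ?case by auto
    next
      case (diff s t)
      then obtain x y where xy: "x \<in> I" "y \<in> I" "s = x $ i" "t = y $ i"
        by (auto simp: P_def)
      then have "s - t = (x - y) $ i"
        using sub(1) i by auto
      then show ?case
        using I_diff[of x y] xy by (auto simp: P_def)
    qed
    then have "d i \<in> P i"
      unfolding d_def using Gcd_in_group_closure[of "P i"] by blast
    then show ?thesis
      unfolding P_def by (metis imageE)
  qed
  have "h \<in> (*\<^sub>v) (mat_diag k d) ` carrier_vec k" if h: "h \<in> I" for h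
  proof -
    have "d i dvd h $ i" for i
      unfolding d_def P_def using h by auto
    then have "h = mat_diag k d *\<^sub>v vec k (\<lambda>i. h $ i div d i)"
      unfolding mat_diag_mult_vec[OF vec_carrier] using sub(1) h by (intro eq_vecI) auto
    then show ?thesis by (rule image_eqI) simp
  qed
  moreover have "mat_diag k d *\<^sub>v x \<in> I" if x: "x \<in> carrier_vec k" for x
  proof -
    \<comment> \<open>Build up the sum of the vectors \<open>x\<^sub>i d\<^sub>i e\<^sub>i\<close> one coordinate at a time.\<close>
    have "vec k (\<lambda>i. if i < m then d i * x $ i else 0) \<in> I" if "m \<le> k" for m
      using that
    proof (induction m)
      case 0
      have "vec k (\<lambda>i. if i < 0 then d i * x $ i else 0) = 0\<^sub>v k"
        by (intro eq_vecI) auto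
      then show ?case using sub(2) by simp
    next
      case (Suc m)
      obtain h where h: "h \<in> I" "h $ m = d m"
        using d_in[of m] Suc.prems by auto
      have "vec k (\<lambda>i. (x $ m \<cdot>\<^sub>v unit_vec k m) $ i * h $ i) \<in> I"
        by (rule ideal_int_vec_ringD[OF I h(1)]) simp
      then have "vec k (\<lambda>i. if i < m then d i * x $ i else 0)
          + vec k (\<lambda>i. (x $ m \<cdot>\<^sub>v unit_vec k m) $ i * h $ i) \<in> I"
        using Suc sub(3) by simp
      also have "vec k (\<lambda>i. if i < m then d i * x $ i else 0)
          + vec k (\<lambda>i. (x $ m \<cdot>\<^sub>v unit_vec k m) $ i * h $ i)
          = vec k (\<lambda>i. if i < Suc m then d i * x $ i else 0)"
        using Suc.prems h(2) by (intro eq_vecI) (auto simp: less_Suc_eq)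
      finally show ?case .
    qed
    from this[of k] have "vec k (\<lambda>i. if i < k then d i * x $ i else 0) \<in> I" by simp
    also have "vec k (\<lambda>i. if i < k then d i * x $ i else 0) = mat_diag k d *\<^sub>v x"
      unfolding mat_diag_mult_vec[OF x] by (intro eq_vecI) auto
    finally show ?thesis .
  qed
  ultimately show ?thesis by blast
qed

lemma ideal_int_vec_ring_iff:
  assumes "additive_subgroup I (int_vec_ring k)"
  shows "ideal I (int_vec_ring k) \<longleftrightarrow> (\<exists>d. I = (*\<^sub>v) (mat_diag k d) ` carrier_vec k)"
proof
  assume "\<exists>d. I = (*\<^sub>v) (mat_diag k d) ` carrier_vec k"
  then obtain d where I: "I = (*\<^sub>v) (mat_diag k d) ` carrier_vec k" by blast
  have closed: "vec k (\<lambda>i. r $ i * a $ i) \<in> I" if a: "a \<in> I" and r: "r \<in> carrier_vec k" for a r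
  proof -
    obtain x where x: "x \<in> carrier_vec k" "a = mat_diag k d *\<^sub>v x"
      using a I by blast
    have "vec k (\<lambda>i. r $ i * a $ i) = mat_diag k d *\<^sub>v vec k (\<lambda>i. r $ i * x $ i)"
      unfolding x(2) mat_diag_mult_vec[OF x(1)] mat_diag_mult_vec[OF vec_carrier]
      by (intro eq_vecI) (simp_all add: mult.left_commute)
    then show ?thesis
      unfolding I by (rule image_eqI) simp
  qed
  show "ideal I (int_vec_ring k)"
  proof (rule idealI)
    show "ring (int_vec_ring k)"
      by (rule cring.axioms(1)[OF cring_int_vec_ring])
    show "subgroup I (add_monoid (int_vec_ring k))"
      by (rule additive_subgroup.a_subgroup[OF assms])
    fix a x assume "a \<in> I" "x \<in> carrier (int_vec_ring k)"
    then have "vec k (\<lambda>i. x $ i * a $ i) \<in> I"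
      using closed by (simp add: int_vec_ring_def)
    then show "x \<otimes>\<^bsub>int_vec_ring k\<^esub> a \<in> I" "a \<otimes>\<^bsub>int_vec_ring k\<^esub> x \<in> I"
      by (simp_all add: int_vec_ring_def mult.commute)
  qed
qed (rule ideal_int_vec_ring_imp_diag)


section \<open>Diagonal right multiples and the adjugate\<close>

text \<open>Entry \<open>(j, i)\<close> of the equation \<open>det A \<cdot> U = adj A \<cdot> D\<close>, divided by \<open>d\<^sub>i\<close>, reads
  \<open>(det A / d\<^sub>i) u\<^sub>j\<^sub>i = a\<^sup>*\<^sub>j\<^sub>i\<close>. So an integral \<open>U\<close> exists exactly under the divisibility condition, and
  \<open>det A \<cdot> det U = det D\<close> turns unimodularity into the condition on the product of the \<open>d\<^sub>i\<close>.\<close>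

lemma exists_unimodular_diag_iff:
  fixes A :: "int mat"
  assumes A: "A \<in> carrier_mat k k" and det: "det A \<noteq> 0"
  shows "(\<exists>U \<in> carrier_mat k k. unimodular_mat U \<and> mat_diag k d = A * U) \<longleftrightarrow>
    (\<forall>i<k. d i \<noteq> 0) \<and> (det A = (\<Prod>i<k. d i) \<or> det A = - (\<Prod>i<k. d i)) \<and>
    (\<forall>i<k. (det A div d i) dvd Gcd ((\<lambda>j. adj_mat A $$ (j, i)) ` {..<k}))"
    (is "?ex \<longleftrightarrow> ?nz \<and> ?prod \<and> ?dvd")
proof
  note adj = adj_mat(1)[OF A]
  note eq_iff = mult_eq_iff_adj_mat[OF A _ mat_diag_dim det]
  have factor: "det A = d i * (det A div d i)" if ?prod "i < k" for i
    using that dvd_prodI[of "{..<k}" i d] by auto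
  show "?nz \<and> ?prod \<and> ?dvd" if ex: ?ex
  proof -
    obtain U where U: "U \<in> carrier_mat k k" "unimodular_mat U" "A * U = mat_diag k d"
      using ex by metis
    have "det U = 1 \<or> det U = -1"
      using U unimodular_mat_iff_is_unit_det by auto
    moreover have "det A * det U = (\<Prod>i<k. d i)"
      using U det_mult[OF A U(1)] det_mat_diag[of k d] by simp
    ultimately have p: ?prod by auto
    then have nz: ?nz
      using det by (auto simp: prod_zero_iff)
    have eq: "det A \<cdot>\<^sub>m U = adj_mat A * mat_diag k d"
      using eq_iff U by blast
    have ent: "det A * U $$ (j, i) = adj_mat A $$ (j, i) * d i" if "i < k" "j < k" for i j
      using arg_cong[OF eq, of "\<lambda>M. M $$ (j, i)"] that U(1)
      unfolding mat_diag_mult_right[OF adj] by simp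
    have "(det A div d i) dvd adj_mat A $$ (j, i)" if "i < k" "j < k" for i j
    proof -
      have "d i * ((det A div d i) * U $$ (j, i)) = d i * adj_mat A $$ (j, i)"
        using ent[OF that] factor[OF p that(1)] by (metis mult.assoc mult.commute)
      then show ?thesis
        using nz that(1) by (metis dvd_triv_left mult_left_cancel)
    qed
    then show ?thesis
      using nz p by (auto intro!: Gcd_greatest)
  qed
  show ?ex if R: "?nz \<and> ?prod \<and> ?dvd"
  proof -
    define U where "U = mat k k (\<lambda>(j, i). adj_mat A $$ (j, i) div (det A div d i))"
    have U: "U \<in> carrier_mat k k" by (simp add: U_def)
    have "det A * U $$ (j, i) = adj_mat A $$ (j, i) * d i" if ij: "i < k" "j < k" for i j
    proof -
      have "(det A div d i) dvd adj_mat A $$ (j, i)"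
        using R ij by (meson Gcd_dvd dvd_trans imageI lessThan_iff)
      then have "(det A div d i) * U $$ (j, i) = adj_mat A $$ (j, i)"
        using ij by (simp add: U_def)
      then show ?thesis
        using factor[of i] R ij by (metis mult.assoc mult.commute)
    qed
    then have "det A \<cdot>\<^sub>m U = adj_mat A * mat_diag k d"
      using U unfolding mat_diag_mult_right[OF adj] by (intro eq_matI) auto
    then have AU: "A * U = mat_diag k d"
      using eq_iff U by blast
    then have "det A * det U = (\<Prod>i<k. d i)"
      using det_mult[OF A U] det_mat_diag[of k d] by simp
    then have "det A * det U = det A * 1 \<or> det A * det U = det A * (-1)"
      using R by auto
    then have "is_unit (det U)"
      using det unfolding mult_left_cancel[OF det] by auto
    then show ?ex
      using U AU unimodular_mat_iff_is_unit_det by metis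
  qed
qed

theorem theorem3p7:
  fixes k :: nat and H :: "int vec set" and A :: "int mat"
  assumes "k \<ge> 1"
    and "additive_subgroup H (int_vec_ring k)"
    and "vec_module.has_free_rank k H k"
    and "A \<in> carrier_mat k k"
    and "distinct (cols A)"
    and "vec_module.free_basis k H (set (cols A))"
  shows "(ideal H (int_vec_ring k) \<longleftrightarrow>
            (\<exists>U \<in> carrier_mat k k. unimodular_mat U \<and> diagonal_mat (A * U))) \<and>
         ((\<exists>U \<in> carrier_mat k k. unimodular_mat U \<and> diagonal_mat (A * U)) \<longleftrightarrow>
            (\<exists>d :: nat \<Rightarrow> int.
               (\<forall>i<k. d i \<noteq> 0) \<and>
               (det A = (\<Prod>i<k. d i) \<or> det A = - (\<Prod>i<k. d i)) \<and>
               (\<forall>i<k. (det A div d i) dvd Gcd ((\<lambda>j. adj_mat A $$ (j, i)) ` {..<k}))))"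
proof -
  note A = assms(4)
  interpret idom_vec k "TYPE(int)" .
  have basis: "lin_indpt (set (cols A))" "span (set (cols A)) = H"
    using assms(6) by (auto simp: free_basis_def)
  have det: "det A \<noteq> 0"
    by (rule lin_indpt_cols_imp_det_nonzero[OF A assms(5) basis(1)])
  have H: "H = (*\<^sub>v) A ` carrier_vec k"
    using span_cols_eq_column_lattice[OF A] basis(2) by simp
  have diag: "(\<exists>U \<in> carrier_mat k k. unimodular_mat U \<and> diagonal_mat (A * U)) \<longleftrightarrow>
      (\<exists>d. \<exists>U \<in> carrier_mat k k. unimodular_mat U \<and> mat_diag k d = A * U)"
    using diagonal_mat_iff_mat_diag[OF mult_carrier_mat[OF A]] by metis
  have "ideal H (int_vec_ring k) \<longleftrightarrow>
      (\<exists>d. \<exists>U \<in> carrier_mat k k. unimodular_mat U \<and> mat_diag k d = A * U)"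
    unfolding ideal_int_vec_ring_iff[OF assms(2)] unfolding H same_lattice_iff[OF A mat_diag_dim det] ..
  then show ?thesis
    unfolding diag exists_unimodular_diag_iff[OF A det] by simp
qed

end
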